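(* Consider the decentralized information structure and let $x_0=(x_0^i)_{i\in\mathfrak{N}}\in\mathbb{X}_0$. Suppose that, for all $t\in\{0,\dots,T-1\}$ and all state and control processes $(\mathbf{X},\mathbf{U})$ satisfying the dynamics (D) and the decentralized measurability constraints (M), the following equivalence holds: $$\big(\Theta_t^i(\mathbf{X}_t^i,\mathbf{U}_t^i)\big)_{i\in\mathfrak{N}}\in-S_t\ \ \mathbb{P}\text{-a.s.}\iff\Big(\exists\,(r_t^i)_{i\in\mathfrak{N}}\in-S_t\ \text{(deterministic)},\quad\Theta_t^i(\mathbf{X}_t^i,\mathbf{U}_t^i)=r_t^i\ \ \mathbb{P}\text{-a.s.}\quad\forall i\in\mathfrak{N}\Big).$$ Then the optimal value $V_0^{\mathrm{D}}(x_0)$ of the decentralized problem satisfies $$V_0^{\mathrm{D}}(x_0)=\inf_{r\in-S}\ \sum_{i\in\mathfrak{N}}\overline{V}_0^i[r^i](x_0^i).$$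
   Context: Data. $\mathfrak{N}$ is a finite set of units, $T\ge1$ an integer. For each $i\in\mathfrak{N}$ there are measurable spaces $\mathbb{X}_t^i$ ($0\le t\le T$), $\mathbb{U}_t^i$ ($0\le t\le T-1$), $\mathbb{W}_t^i$ ($1\le t\le T$), and measurable vector spaces $\mathcal{R}_t^i$, $0\le t\le T-1$. For $0\le t\le T-1$ there are measurable maps $g_t^i:\mathbb{X}_t^i\times\mathbb{U}_t^i\times\mathbb{W}_{t+1}^i\to\mathbb{X}_{t+1}^i$, $\Theta_t^i:\mathbb{X}_t^i\times\mathbb{U}_t^i\to\mathcal{R}_t^i$, $L_t^i:\mathbb{X}_t^i\times\mathbb{U}_t^i\times\mathbb{W}_{t+1}^i\to(-\infty,+\infty]$, and $K^i:\mathbb{X}_T^i\to(-\infty,+\infty]$ is measurable. Set $\mathbb{X}_t=\prod_i\mathbb{X}_t^i$, $\mathcal{R}_t=\prod_i\mathcal{R}_t^i$. A subset $S_t\subset\mathcal{R}_t$ is given for each $0\le t\le T-1$, and $S=\prod_{t=0}^{T-1}S_t$; for $r=(r_t^i)_{t,i}\in-S$ write $r^i=(r_0^i,\dots,r_{T-1}^i)$. Noise and information. On a probability space $(\Omega,\mathcal{A},\mathbb{P})$ there are random variables $\mathbf{W}_t^i:\Omega\to\mathbb{W}_t^i$, $1\le t\le T$; $\mathbf{W}_t=(\mathbf{W}_t^i)_i$, and $\mathbf{W}_1,\dots,\mathbf{W}_T$ are independent (standing assumption). $\mathcal{F}_t^i=\sigma(\mathbf{W}_1^i,\dots,\mathbf{W}_t^i)$,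 $\mathcal{F}_0^i=\{\emptyset,\Omega\}$. Constraints, for processes $(\mathbf{X}_t^i)_{0\le t\le T}$, $(\mathbf{U}_t^i)_{0\le t\le T-1}$: (D) $\mathbf{X}_0^i=x_0^i$ and $\mathbf{X}_{t+1}^i=g_t^i(\mathbf{X}_t^i,\mathbf{U}_t^i,\mathbf{W}_{t+1}^i)$ for all $t\in\{0,\dots,T-1\}$; (M) $\sigma(\mathbf{U}_t^i)\subset\mathcal{F}_t^i$ for all $t\in\{0,\dots,T-1\}$. Decentralized problem: $V_0^{\mathrm{D}}(x_0)=\inf\mathbb{E}\big[\sum_{i}\sum_{t=0}^{T-1}L_t^i(\mathbf{X}_t^i,\mathbf{U}_t^i,\mathbf{W}_{t+1}^i)+\sum_iK^i(\mathbf{X}_T^i)\big]$ over all $(\mathbf{X},\mathbf{U})$ satisfying (D) and (M) for all $i\in\mathfrak{N}$ and $(\Theta_t^i(\mathbf{X}_t^i,\mathbf{U}_t^i))_{i}\in-S_t$ $\mathbb{P}$-a.s. for all $t\in\{0,\dots,T-1\}$. Local resource value function for a deterministic $r^i$: $\overline{V}_0^i[r^i](x_0^i)=\inf\mathbb{E}\big[\sum_{t=0}^{T-1}L_t^i(\mathbf{X}_t^i,\mathbf{U}_t^i,\mathbf{W}_{t+1}^i)+K^i(\mathbf{X}_T^i)\big]$ over all $(\mathbf{X}^i,\mathbf{U}^i)$ satisfying (D), (M) and $\Theta_t^i(\mathbf{X}_t^i,\mathbf{U}_t^i)=r_t^i$ $\mathbb{P}$-a.s. for all $t\in\{0,\dots,T-1\}$.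 Standing assumptions: measurability and integrability assumptions hold so that all expectations are well defined; $\overline{V}_0^i[r^i](x_0^i)>-\infty$. An infimum over the empty set is $+\infty$. *)

theory Defs
  imports "HOL-Probability.Probability"
begin

text \<open>
  Families of spaces indexed by time and unit are families of measure-space structures on one
  common carrier type, each space being \<^term>\<open>space\<close> of its member; only the underlying measurable
  structure of \<open>X_sp\<close>, \<open>U_sp\<close>, \<open>W_sp\<close> and \<open>R_sp\<close> is used. Products over units are sets of
  functions that are \<^const>\<open>undefined\<close> outside the set of units.
\<close>

record ('i, 'x, 'u, 'w, 'r, 'o) multiunit =
  Units :: "'i set"
  Horizon :: nat
  X_sp :: "nat \<Rightarrow> 'i \<Rightarrow> 'x measure"
  U_sp :: "nat \<Rightarrow> 'i \<Rightarrow> 'u measure"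
  W_sp :: "nat \<Rightarrow> 'i \<Rightarrow> 'w measure"
  R_sp :: "nat \<Rightarrow> 'i \<Rightarrow> 'r measure"
  dyn :: "nat \<Rightarrow> 'i \<Rightarrow> 'x \<times> 'u \<times> 'w \<Rightarrow> 'x"
  Theta :: "nat \<Rightarrow> 'i \<Rightarrow> 'x \<times> 'u \<Rightarrow> 'r"
  stage_cost :: "nat \<Rightarrow> 'i \<Rightarrow> 'x \<times> 'u \<times> 'w \<Rightarrow> ereal"
  final_cost :: "'i \<Rightarrow> 'x \<Rightarrow> ereal"
  S_set :: "nat \<Rightarrow> ('i \<Rightarrow> 'r) set"
  Prob :: "'o measure"
  Noise :: "nat \<Rightarrow> 'i \<Rightarrow> 'o \<Rightarrow> 'w"

text \<open>
  The vector space is a linear subspace of the ambient type, so that members of a family may be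
  different (arbitrary) vector spaces.
\<close>

definition measurable_vector_space :: "'r::real_vector measure \<Rightarrow> bool" where
  "measurable_vector_space R \<longleftrightarrow>
     subspace (space R) \<and>
     (\<lambda>(a, b). a + b) \<in> R \<Otimes>\<^sub>M R \<rightarrow>\<^sub>M R \<and>
     (\<lambda>(c, a). c *\<^sub>R a) \<in> (borel :: real measure) \<Otimes>\<^sub>M R \<rightarrow>\<^sub>M R"

locale multiunit_problem =
  prob_space "Prob D" for D :: "('i, 'x, 'u, 'w, 'r::real_vector, 'o) multiunit" +
  assumes finite_units: "finite (Units D)"
    and horizon_ge_1: "1 \<le> Horizon D"
    and R_sp_vector: "\<And>t i. \<lbrakk>t < Horizon D; i \<in> Units D\<rbrakk> \<Longrightarrow> measurable_vector_space (R_sp D t i)"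
    and dyn_measurable: "\<And>t i. \<lbrakk>t < Horizon D; i \<in> Units D\<rbrakk> \<Longrightarrow>
      dyn D t i \<in> X_sp D t i \<Otimes>\<^sub>M (U_sp D t i \<Otimes>\<^sub>M W_sp D (Suc t) i) \<rightarrow>\<^sub>M X_sp D (Suc t) i"
    and Theta_measurable: "\<And>t i. \<lbrakk>t < Horizon D; i \<in> Units D\<rbrakk> \<Longrightarrow>
      Theta D t i \<in> X_sp D t i \<Otimes>\<^sub>M U_sp D t i \<rightarrow>\<^sub>M R_sp D t i"
    and stage_cost_measurable: "\<And>t i. \<lbrakk>t < Horizon D; i \<in> Units D\<rbrakk> \<Longrightarrow>
      stage_cost D t i \<in> borel_measurable (X_sp D t i \<Otimes>\<^sub>M (U_sp D t i \<Otimes>\<^sub>M W_sp D (Suc t) i))"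
    and stage_cost_gt: "\<And>t i z. \<lbrakk>t < Horizon D; i \<in> Units D;
      z \<in> space (X_sp D t i \<Otimes>\<^sub>M (U_sp D t i \<Otimes>\<^sub>M W_sp D (Suc t) i))\<rbrakk> \<Longrightarrow> - \<infinity> < stage_cost D t i z"
    and final_cost_measurable: "\<And>i. i \<in> Units D \<Longrightarrow>
      final_cost D i \<in> borel_measurable (X_sp D (Horizon D) i)"
    and final_cost_gt: "\<And>i z. \<lbrakk>i \<in> Units D; z \<in> space (X_sp D (Horizon D) i)\<rbrakk> \<Longrightarrow>
      - \<infinity> < final_cost D i z"
    and S_set_subset: "\<And>t. t < Horizon D \<Longrightarrow> S_set D t \<subseteq> (\<Pi>\<^sub>E i\<in>Units D. space (R_sp D t i))"
    and Noise_measurable: "\<And>t i. \<lbrakk>t \<in> {1..Horizon D}; i \<in> Units D\<rbrakk> \<Longrightarrow>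
      Noise D t i \<in> Prob D \<rightarrow>\<^sub>M W_sp D t i"
    and Noise_indep: "indep_vars (\<lambda>t. \<Pi>\<^sub>M i\<in>Units D. W_sp D t i)
      (\<lambda>t \<omega>. \<lambda>i\<in>Units D. Noise D t i \<omega>) {1..Horizon D}"

text \<open>Since \<^const>\<open>sigma\<close> of the empty family is trivial, this covers time 0.\<close>

definition info :: "('i, 'x, 'u, 'w, 'r, 'o) multiunit \<Rightarrow> nat \<Rightarrow> 'i \<Rightarrow> 'o measure" where
  "info D t i = sigma (space (Prob D))
     (\<Union>s\<in>{1..t}. {Noise D s i -` A \<inter> space (Prob D) | A. A \<in> sets (W_sp D s i)})"

definition local_process ::
  "('i, 'x, 'u, 'w, 'r, 'o) multiunit \<Rightarrow> 'i \<Rightarrow> (nat \<Rightarrow> 'o \<Rightarrow> 'x) \<Rightarrow> (nat \<Rightarrow> 'o \<Rightarrow> 'u) \<Rightarrow> bool" where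
  "local_process D i X U \<longleftrightarrow>
     (\<forall>t\<le>Horizon D. X t \<in> Prob D \<rightarrow>\<^sub>M X_sp D t i) \<and>
     (\<forall>t<Horizon D. U t \<in> Prob D \<rightarrow>\<^sub>M U_sp D t i)"

definition dynamics ::
  "('i, 'x, 'u, 'w, 'r, 'o) multiunit \<Rightarrow> 'i \<Rightarrow> 'x \<Rightarrow> (nat \<Rightarrow> 'o \<Rightarrow> 'x) \<Rightarrow> (nat \<Rightarrow> 'o \<Rightarrow> 'u) \<Rightarrow> bool" where
  "dynamics D i x X U \<longleftrightarrow>
     (\<forall>\<omega>\<in>space (Prob D). X 0 \<omega> = x \<and>
       (\<forall>t<Horizon D. X (Suc t) \<omega> = dyn D t i (X t \<omega>, U t \<omega>, Noise D (Suc t) i \<omega>)))"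

definition nonanticipative ::
  "('i, 'x, 'u, 'w, 'r, 'o) multiunit \<Rightarrow> 'i \<Rightarrow> (nat \<Rightarrow> 'o \<Rightarrow> 'u) \<Rightarrow> bool" where
  "nonanticipative D i U \<longleftrightarrow>
     (\<forall>t<Horizon D. sets (vimage_algebra (space (Prob D)) (U t) (U_sp D t i)) \<subseteq> sets (info D t i))"

definition admissible_local ::
  "('i, 'x, 'u, 'w, 'r, 'o) multiunit \<Rightarrow> 'i \<Rightarrow> 'x \<Rightarrow> (nat \<Rightarrow> 'o \<Rightarrow> 'x) \<Rightarrow> (nat \<Rightarrow> 'o \<Rightarrow> 'u) \<Rightarrow> bool" where
  "admissible_local D i x X U \<longleftrightarrow>
     local_process D i X U \<and> dynamics D i x X U \<and> nonanticipative D i U"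

definition admissible ::
  "('i, 'x, 'u, 'w, 'r, 'o) multiunit \<Rightarrow> ('i \<Rightarrow> 'x) \<Rightarrow>
   (nat \<Rightarrow> 'i \<Rightarrow> 'o \<Rightarrow> 'x) \<Rightarrow> (nat \<Rightarrow> 'i \<Rightarrow> 'o \<Rightarrow> 'u) \<Rightarrow> bool" where
  "admissible D x0 X U \<longleftrightarrow>
     (\<forall>i\<in>Units D. admissible_local D i (x0 i) (\<lambda>t. X t i) (\<lambda>t. U t i))"

definition neg_S :: "('i, 'x, 'u, 'w, 'r::real_vector, 'o) multiunit \<Rightarrow> nat \<Rightarrow> ('i \<Rightarrow> 'r) set" where
  "neg_S D t = (\<lambda>s. \<lambda>i\<in>Units D. - s i) ` S_set D t"

definition neg_S_prod ::
  "('i, 'x, 'u, 'w, 'r::real_vector, 'o) multiunit \<Rightarrow> (nat \<Rightarrow> 'i \<Rightarrow> 'r) set" where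
  "neg_S_prod D = (\<Pi>\<^sub>E t\<in>{..<Horizon D}. neg_S D t)"

definition coupling_constraint ::
  "('i, 'x, 'u, 'w, 'r::real_vector, 'o) multiunit \<Rightarrow> nat \<Rightarrow>
   (nat \<Rightarrow> 'i \<Rightarrow> 'o \<Rightarrow> 'x) \<Rightarrow> (nat \<Rightarrow> 'i \<Rightarrow> 'o \<Rightarrow> 'u) \<Rightarrow> bool" where
  "coupling_constraint D t X U \<longleftrightarrow>
     (AE \<omega> in Prob D. (\<lambda>i\<in>Units D. Theta D t i (X t i \<omega>, U t i \<omega>)) \<in> neg_S D t)"

text \<open>
  Extended-real expectation as positive part minus negative part (\<^const>\<open>e2ennreal\<close> sends negative
  values to 0). It is meaningful only under \<open>expectation_defined\<close>.
\<close>

definition expectation_defined :: "'o measure \<Rightarrow> ('o \<Rightarrow> ereal) \<Rightarrow> bool" where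
  "expectation_defined M Y \<longleftrightarrow>
     Y \<in> borel_measurable M \<and>
     ((\<integral>\<^sup>+ \<omega>. e2ennreal (Y \<omega>) \<partial>M) < \<infinity> \<or> (\<integral>\<^sup>+ \<omega>. e2ennreal (- Y \<omega>) \<partial>M) < \<infinity>)"

definition ereal_expectation :: "'o measure \<Rightarrow> ('o \<Rightarrow> ereal) \<Rightarrow> ereal" where
  "ereal_expectation M Y =
     enn2ereal (\<integral>\<^sup>+ \<omega>. e2ennreal (Y \<omega>) \<partial>M) - enn2ereal (\<integral>\<^sup>+ \<omega>. e2ennreal (- Y \<omega>) \<partial>M)"

definition local_cost ::
  "('i, 'x, 'u, 'w, 'r, 'o) multiunit \<Rightarrow> 'i \<Rightarrow> (nat \<Rightarrow> 'o \<Rightarrow> 'x) \<Rightarrow> (nat \<Rightarrow> 'o \<Rightarrow> 'u) \<Rightarrow> 'o \<Rightarrow> ereal" where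
  "local_cost D i X U \<omega> =
     (\<Sum>t<Horizon D. stage_cost D t i (X t \<omega>, U t \<omega>, Noise D (Suc t) i \<omega>)) +
     final_cost D i (X (Horizon D) \<omega>)"

definition total_cost ::
  "('i, 'x, 'u, 'w, 'r, 'o) multiunit \<Rightarrow>
   (nat \<Rightarrow> 'i \<Rightarrow> 'o \<Rightarrow> 'x) \<Rightarrow> (nat \<Rightarrow> 'i \<Rightarrow> 'o \<Rightarrow> 'u) \<Rightarrow> 'o \<Rightarrow> ereal" where
  "total_cost D X U \<omega> =
     (\<Sum>i\<in>Units D. \<Sum>t<Horizon D.
        stage_cost D t i (X t i \<omega>, U t i \<omega>, Noise D (Suc t) i \<omega>)) +
     (\<Sum>i\<in>Units D. final_cost D i (X (Horizon D) i \<omega>))"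

definition dec_feasible ::
  "('i, 'x, 'u, 'w, 'r::real_vector, 'o) multiunit \<Rightarrow> ('i \<Rightarrow> 'x) \<Rightarrow>
   ((nat \<Rightarrow> 'i \<Rightarrow> 'o \<Rightarrow> 'x) \<times> (nat \<Rightarrow> 'i \<Rightarrow> 'o \<Rightarrow> 'u)) set" where
  "dec_feasible D x0 =
     {(X, U). admissible D x0 X U \<and> (\<forall>t<Horizon D. coupling_constraint D t X U)}"

definition local_feasible ::
  "('i, 'x, 'u, 'w, 'r, 'o) multiunit \<Rightarrow> 'i \<Rightarrow> (nat \<Rightarrow> 'r) \<Rightarrow> 'x \<Rightarrow>
   ((nat \<Rightarrow> 'o \<Rightarrow> 'x) \<times> (nat \<Rightarrow> 'o \<Rightarrow> 'u)) set" where
  "local_feasible D i r x =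
     {(X, U). admissible_local D i x X U \<and>
        (\<forall>t<Horizon D. AE \<omega> in Prob D. Theta D t i (X t \<omega>, U t \<omega>) = r t)}"

definition V_dec ::
  "('i, 'x, 'u, 'w, 'r::real_vector, 'o) multiunit \<Rightarrow> ('i \<Rightarrow> 'x) \<Rightarrow> ereal" where
  "V_dec D x0 = (INF (X, U)\<in>dec_feasible D x0. ereal_expectation (Prob D) (total_cost D X U))"

definition V_local ::
  "('i, 'x, 'u, 'w, 'r, 'o) multiunit \<Rightarrow> 'i \<Rightarrow> (nat \<Rightarrow> 'r) \<Rightarrow> 'x \<Rightarrow> ereal" where
  "V_local D i r x = (INF (X, U)\<in>local_feasible D i r x. ereal_expectation (Prob D) (local_cost D i X U))"

end

theory Submission
  imports Defs
begin

text \<open>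
  The coupling constraint is the only link between the units. Under the equivalence hypothesis,
  feasibility for the decentralized problem means that some deterministic allocation \<open>r\<close> makes
  every local pair \<open>(X\<^sup>i, U\<^sup>i)\<close> feasible for the local problem with resource \<open>r\<^sup>i\<close>
  (\<open>dec_feasible_iff_local_feasible\<close>). Hence the feasible set of the decentralized problem is the
  union over \<open>r\<close> of products of local feasible sets, and the total cost is the sum of the local costs.

  It remains to move the expectation and the infimum inside the sum over units, which can fail when
  \<open>\<infinity>\<close> meets \<open>-\<infinity>\<close>. Pointwise, costs never equal \<open>-\<infinity>\<close> (\<open>local_cost_gt\<close>). A local value above
  \<open>-\<infinity>\<close> forces the cost of every feasible local pair to have an integrable negative part
  (\<open>negative_part_finite\<close>), so that expectations add up (\<open>ereal_expectation_sum\<close>), and it allows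
  choosing nearly optimal local controls for all units at once (\<open>sum_INF_eq_INF_sum\<close>).
\<close>

section \<open>Additivity of the extended-real expectation\<close>

lemma e2ennreal_ereal_eq_max: "e2ennreal (ereal z) = ennreal (max 0 z)"
  by (cases "0 \<le> z") (auto simp: ennreal_neg max_def)

text \<open>
  Moving negative parts across the equality keeps every term nonnegative, so that the identity
  can be integrated without subtracting infinities.
\<close>

lemma e2ennreal_add_parts:
  fixes a b :: ereal
  assumes "- \<infinity> < a" "- \<infinity> < b"
  shows "e2ennreal (a + b) + (e2ennreal (- a) + e2ennreal (- b)) =
    e2ennreal (- (a + b)) + (e2ennreal a + e2ennreal b)"
proof (cases "a = \<infinity> \<or> b = \<infinity>")
  case True
  then have "a + b = \<infinity>" using assms by (cases a; cases b) auto
  then show ?thesis using True by auto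
next
  case False
  then obtain x y where xy: "a = ereal x" "b = ereal y"
    using assms by (cases a; cases b) auto
  have "ennreal (max 0 (x + y) + (max 0 (- x) + max 0 (- y))) =
      ennreal (max 0 (- (x + y)) + (max 0 x + max 0 y))"
    by (rule arg_cong[where f = ennreal]) (auto simp: max_def)
  then show ?thesis
    unfolding xy by (simp add: e2ennreal_ereal_eq_max ennreal_plus del: ennreal_plus_if e2ennreal_ereal)
qed

lemma e2ennreal_uminus_add_le:
  fixes a b :: ereal
  assumes "- \<infinity> < a" "- \<infinity> < b"
  shows "e2ennreal (- (a + b)) \<le> e2ennreal (- a) + e2ennreal (- b)"
proof (cases "a = \<infinity> \<or> b = \<infinity>")
  case True
  then have "a + b = \<infinity>" using assms by (cases a; cases b) auto
  then show ?thesis by (simp only:) (simp add: e2ennreal_neg)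
next
  case False
  then obtain x y where xy: "a = ereal x" "b = ereal y"
    using assms by (cases a; cases b) auto
  have "ennreal (max 0 (- (x + y))) \<le> ennreal (max 0 (- x) + max 0 (- y))"
    by (rule ennreal_leI) (auto simp: max_def)
  then show ?thesis
    unfolding xy by (simp add: e2ennreal_ereal_eq_max ennreal_plus del: ennreal_plus_if e2ennreal_ereal)
qed

lemma ereal_diff_eq_add_diff:
  fixes p a c :: ereal
  assumes "p + (ereal b + ereal d) = ereal n + (a + c)" "p \<noteq> - \<infinity>" "a \<noteq> - \<infinity>" "c \<noteq> - \<infinity>"
  shows "p - ereal n = (a - ereal b) + (c - ereal d)"
  using assms by (cases p; cases a; cases c) auto

lemma enn2ereal_diff_eq_add_diff:
  fixes p n a b c d :: ennreal
  assumes eq: "p + (b + d) = n + (a + c)" and "n < \<infinity>" "b < \<infinity>" "d < \<infinity>"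
  shows "enn2ereal p - enn2ereal n =
    (enn2ereal a - enn2ereal b) + (enn2ereal c - enn2ereal d)"
proof -
  have eq': "enn2ereal p + (enn2ereal b + enn2ereal d) =
      enn2ereal n + (enn2ereal a + enn2ereal c)"
    unfolding plus_ennreal.rep_eq[symmetric] eq ..
  have real: "\<exists>z. enn2ereal x = ereal z" if "x < \<infinity>" for x
    using that by (cases x) auto
  obtain n' b' d' where reals: "enn2ereal n = ereal n'" "enn2ereal b = ereal b'"
      "enn2ereal d = ereal d'"
    using real[OF assms(2)] real[OF assms(3)] real[OF assms(4)] by blast
  have not_MInfty: "enn2ereal x \<noteq> - \<infinity>" for x
    using enn2ereal_nonneg[of x] by auto
  show ?thesis
    using ereal_diff_eq_add_diff[OF eq'[unfolded reals] not_MInfty not_MInfty not_MInfty]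
    unfolding reals .
qed

lemma ereal_expectation_add:
  assumes [measurable]: "Y \<in> borel_measurable M" "Z \<in> borel_measurable M"
    and gt: "\<And>\<omega>. \<omega> \<in> space M \<Longrightarrow> - \<infinity> < Y \<omega>" "\<And>\<omega>. \<omega> \<in> space M \<Longrightarrow> - \<infinity> < Z \<omega>"
    and fin: "(\<integral>\<^sup>+ \<omega>. e2ennreal (- Y \<omega>) \<partial>M) < \<infinity>" "(\<integral>\<^sup>+ \<omega>. e2ennreal (- Z \<omega>) \<partial>M) < \<infinity>"
  shows "(\<integral>\<^sup>+ \<omega>. e2ennreal (- (Y \<omega> + Z \<omega>)) \<partial>M) < \<infinity>" (is ?finite)
    and "ereal_expectation M (\<lambda>\<omega>. Y \<omega> + Z \<omega>) = ereal_expectation M Y + ereal_expectation M Z"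
      (is ?sum)
proof -
  have "(\<integral>\<^sup>+ \<omega>. e2ennreal (- (Y \<omega> + Z \<omega>)) \<partial>M)
      \<le> (\<integral>\<^sup>+ \<omega>. e2ennreal (- Y \<omega>) + e2ennreal (- Z \<omega>) \<partial>M)"
    by (intro nn_integral_mono e2ennreal_uminus_add_le gt)
  also have "\<dots> = (\<integral>\<^sup>+ \<omega>. e2ennreal (- Y \<omega>) \<partial>M) + (\<integral>\<^sup>+ \<omega>. e2ennreal (- Z \<omega>) \<partial>M)"
    by (rule nn_integral_add) measurable
  also have "\<dots> < \<infinity>" using fin by (simp add: ennreal_add_less_top)
  finally show finite: ?finite .
  have "(\<integral>\<^sup>+ \<omega>. e2ennreal (Y \<omega> + Z \<omega>) + (e2ennreal (- Y \<omega>) + e2ennreal (- Z \<omega>)) \<partial>M) =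
      (\<integral>\<^sup>+ \<omega>. e2ennreal (- (Y \<omega> + Z \<omega>)) + (e2ennreal (Y \<omega>) + e2ennreal (Z \<omega>)) \<partial>M)"
    by (intro nn_integral_cong e2ennreal_add_parts gt)
  then have "(\<integral>\<^sup>+ \<omega>. e2ennreal (Y \<omega> + Z \<omega>) \<partial>M) +
        ((\<integral>\<^sup>+ \<omega>. e2ennreal (- Y \<omega>) \<partial>M) + (\<integral>\<^sup>+ \<omega>. e2ennreal (- Z \<omega>) \<partial>M)) =
      (\<integral>\<^sup>+ \<omega>. e2ennreal (- (Y \<omega> + Z \<omega>)) \<partial>M) +
        ((\<integral>\<^sup>+ \<omega>. e2ennreal (Y \<omega>) \<partial>M) + (\<integral>\<^sup>+ \<omega>. e2ennreal (Z \<omega>) \<partial>M))"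
    by (simp add: nn_integral_add)
  then show ?sum
    unfolding ereal_expectation_def using finite fin by (rule enn2ereal_diff_eq_add_diff)
qed

lemma sum_ereal_gt_MInfty:
  fixes f :: "'a \<Rightarrow> ereal"
  assumes "\<And>i. i \<in> I \<Longrightarrow> - \<infinity> < f i"
  shows "- \<infinity> < (\<Sum>i\<in>I. f i)"
  using assms by (induction I rule: infinite_finite_induct) auto

lemma ereal_expectation_sum:
  assumes "finite I"
    and meas: "\<And>i. i \<in> I \<Longrightarrow> Y i \<in> borel_measurable M"
    and gt: "\<And>i \<omega>. i \<in> I \<Longrightarrow> \<omega> \<in> space M \<Longrightarrow> - \<infinity> < Y i \<omega>"
    and fin: "\<And>i. i \<in> I \<Longrightarrow> (\<integral>\<^sup>+ \<omega>. e2ennreal (- Y i \<omega>) \<partial>M) < \<infinity>"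
  shows "ereal_expectation M (\<lambda>\<omega>. \<Sum>i\<in>I. Y i \<omega>) = (\<Sum>i\<in>I. ereal_expectation M (Y i))"
proof -
  \<comment> \<open>Finiteness of the negative part must be carried along, being what allows one more summand.\<close>
  have "ereal_expectation M (\<lambda>\<omega>. \<Sum>i\<in>I. Y i \<omega>) = (\<Sum>i\<in>I. ereal_expectation M (Y i)) \<and>
      (\<integral>\<^sup>+ \<omega>. e2ennreal (- (\<Sum>i\<in>I. Y i \<omega>)) \<partial>M) < \<infinity>"
    using assms
  proof (induction I rule: finite_induct)
    case empty
    show ?case by (simp add: ereal_expectation_def zero_ennreal.rep_eq)
  next
    case (insert i I)
    let ?S = "\<lambda>\<omega>. \<Sum>j\<in>I. Y j \<omega>"
    have IH: "ereal_expectation M ?S = (\<Sum>j\<in>I. ereal_expectation M (Y j))"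
      "(\<integral>\<^sup>+ \<omega>. e2ennreal (- ?S \<omega>) \<partial>M) < \<infinity>"
      using insert.IH insert.prems by auto
    have Y: "Y i \<in> borel_measurable M" "\<And>\<omega>. \<omega> \<in> space M \<Longrightarrow> - \<infinity> < Y i \<omega>"
      "(\<integral>\<^sup>+ \<omega>. e2ennreal (- Y i \<omega>) \<partial>M) < \<infinity>"
      using insert.prems by auto
    have S: "?S \<in> borel_measurable M" using insert.prems by auto
    have S_gt: "- \<infinity> < ?S \<omega>" if "\<omega> \<in> space M" for \<omega>
      by (rule sum_ereal_gt_MInfty) (rule insert.prems(2)[OF insertI2 that])
    note add = ereal_expectation_add[OF Y(1) S Y(2) S_gt Y(3) IH(2)]
    show ?case using add IH(1) insert.hyps by simp
  qed
  then show ?thesis by blast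
qed

text \<open>
  An infinite negative part would leave a finite positive part, and then an expectation of \<open>-\<infinity>\<close>.
\<close>

lemma negative_part_finite:
  assumes "expectation_defined M Y" "- \<infinity> < ereal_expectation M Y"
  shows "(\<integral>\<^sup>+ \<omega>. e2ennreal (- Y \<omega>) \<partial>M) < \<infinity>"
proof (rule ccontr)
  assume "\<not> ?thesis"
  then have neg: "(\<integral>\<^sup>+ \<omega>. e2ennreal (- Y \<omega>) \<partial>M) = top" by (simp add: not_less top_unique)
  then have "(\<integral>\<^sup>+ \<omega>. e2ennreal (Y \<omega>) \<partial>M) < top"
    using assms(1) by (auto simp: expectation_defined_def)
  then obtain p where "0 \<le> p" "(\<integral>\<^sup>+ \<omega>. e2ennreal (Y \<omega>) \<partial>M) = ennreal p"
    by (metis ennreal_cases less_top)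
  then have "ereal_expectation M Y = - \<infinity>"
    using neg by (simp add: ereal_expectation_def top_ereal_def)
  then show False using assms(2) by simp
qed

section \<open>Infima of separable sums\<close>

text \<open>
  The choices for different indices are independent, so each can be taken within \<open>d\<close> of its own
  infimum when all infima are finite. If some infimum is \<open>\<infinity>\<close>, the left-hand sum is \<open>\<infinity>\<close> and
  bounds the right-hand side trivially.
\<close>

lemma sum_INF_eq_INF_sum:
  fixes f :: "'a \<Rightarrow> 'b \<Rightarrow> ereal"
  assumes fin: "finite I" and gt: "\<And>i. i \<in> I \<Longrightarrow> - \<infinity> < (INF x\<in>A i. f i x)"
  shows "(\<Sum>i\<in>I. INF x\<in>A i. f i x) = (INF z\<in>Pi\<^sub>E I A. \<Sum>i\<in>I. f i (z i))"
proof (rule antisym)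
  show "(\<Sum>i\<in>I. INF x\<in>A i. f i x) \<le> (INF z\<in>Pi\<^sub>E I A. \<Sum>i\<in>I. f i (z i))"
    by (intro INF_greatest sum_mono INF_lower) (auto dest: PiE_mem)
next
  let ?m = "\<lambda>i. INF x\<in>A i. f i x"
  show "(INF z\<in>Pi\<^sub>E I A. \<Sum>i\<in>I. f i (z i)) \<le> (\<Sum>i\<in>I. ?m i)"
  proof (cases "\<exists>i\<in>I. ?m i = \<infinity>")
    case True
    then have "(\<Sum>i\<in>I. ?m i) = \<infinity>" using fin by (subst sum_Pinfty) auto
    then show ?thesis by simp
  next
    case False
    then have real: "\<bar>?m i\<bar> \<noteq> \<infinity>" if "i \<in> I" for i using gt[OF that] that by auto
    show ?thesis
    proof (rule ereal_le_epsilon2)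
      fix e :: real assume e: "0 < e"
      \<comment> \<open>Dividing by the cardinality alone would give 0 for an empty index set.\<close>
      define d where "d = e / (real (card I) + 1)"
      have d: "0 < d" using e by (simp add: d_def add_nonneg_pos)
      have "\<exists>x\<in>A i. f i x < ?m i + ereal d" if "i \<in> I" for i
      proof -
        have "?m i < ?m i + ereal d" using real[OF that] d by (cases "?m i") auto
        then show ?thesis by (simp only: INF_less_iff)
      qed
      then obtain g where g: "\<And>i. i \<in> I \<Longrightarrow> g i \<in> A i \<and> f i (g i) < ?m i + ereal d" by metis
      have "(INF z\<in>Pi\<^sub>E I A. \<Sum>i\<in>I. f i (z i)) \<le> (\<Sum>i\<in>I. f i (restrict g I i))"
        by (rule INF_lower) (use g in auto)
      also have "\<dots> \<le> (\<Sum>i\<in>I. ?m i + ereal d)"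
        by (rule sum_mono) (use g in \<open>auto intro: less_imp_le\<close>)
      also have "\<dots> = (\<Sum>i\<in>I. ?m i) + ereal (real (card I) * d)"
        by (simp add: sum.distrib)
      also have "\<dots> \<le> (\<Sum>i\<in>I. ?m i) + ereal e"
        using e by (intro add_left_mono) (simp add: d_def field_simps)
      finally show "(INF z\<in>Pi\<^sub>E I A. \<Sum>i\<in>I. f i (z i)) \<le> (\<Sum>i\<in>I. ?m i) + ereal e" .
    qed
  qed
qed

section \<open>Decomposition over units\<close>

lemma total_cost_eq_sum_local_cost:
  "total_cost D X U \<omega> = (\<Sum>i\<in>Units D. local_cost D i (\<lambda>t. X t i) (\<lambda>t. U t i) \<omega>)"
  unfolding total_cost_def local_cost_def by (simp add: sum.distrib)

lemma (in multiunit_problem) local_cost_gt: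
  assumes i: "i \<in> Units D" and proc: "local_process D i X U" and \<omega>: "\<omega> \<in> space (Prob D)"
  shows "- \<infinity> < local_cost D i X U \<omega>"
proof -
  have "- \<infinity> < stage_cost D t i (X t \<omega>, U t \<omega>, Noise D (Suc t) i \<omega>)" if t: "t < Horizon D" for t
  proof -
    have "X t \<in> Prob D \<rightarrow>\<^sub>M X_sp D t i" "U t \<in> Prob D \<rightarrow>\<^sub>M U_sp D t i"
      using proc t by (auto simp: local_process_def)
    then have "X t \<omega> \<in> space (X_sp D t i)" "U t \<omega> \<in> space (U_sp D t i)"
      using \<omega> by (auto dest: measurable_space)
    moreover have "Noise D (Suc t) i \<omega> \<in> space (W_sp D (Suc t) i)"
      using Noise_measurable[of "Suc t" i] t i \<omega> by (auto intro: measurable_space)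
    ultimately show ?thesis
      using stage_cost_gt[OF t i, of "(X t \<omega>, U t \<omega>, Noise D (Suc t) i \<omega>)"]
      by (auto simp: space_pair_measure)
  qed
  then have "- \<infinity> < (\<Sum>t<Horizon D. stage_cost D t i (X t \<omega>, U t \<omega>, Noise D (Suc t) i \<omega>))"
    by (intro sum_ereal_gt_MInfty) simp
  moreover have "X (Horizon D) \<omega> \<in> space (X_sp D (Horizon D) i)"
    using proc \<omega> by (auto simp: local_process_def intro: measurable_space)
  then have "- \<infinity> < final_cost D i (X (Horizon D) \<omega>)"
    using final_cost_gt[OF i] by blast
  ultimately show ?thesis unfolding local_cost_def by simp
qed

text \<open>
  The equivalence hypothesis gives a deterministic resource vector at each time separately; as the
  constraint set \<open>S\<close> is a product over time, these vectors form one allocation \<open>r \<in> -S\<close>.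
\<close>

lemma dec_feasible_iff_local_feasible:
  assumes equivalence: "\<And>t X U. \<lbrakk>t < Horizon D; admissible D x0 X U\<rbrakk> \<Longrightarrow>
      coupling_constraint D t X U \<longleftrightarrow>
      (\<exists>r\<in>neg_S D t. \<forall>i\<in>Units D. AE \<omega> in Prob D. Theta D t i (X t i \<omega>, U t i \<omega>) = r i)"
  shows "(X, U) \<in> dec_feasible D x0 \<longleftrightarrow>
    admissible D x0 X U \<and>
    (\<exists>r\<in>neg_S_prod D. \<forall>i\<in>Units D.
       ((\<lambda>t. X t i), (\<lambda>t. U t i)) \<in> local_feasible D i (\<lambda>t. r t i) (x0 i))"
proof (cases "admissible D x0 X U")
  case True
  let ?P = "\<lambda>t r. \<forall>i\<in>Units D. AE \<omega> in Prob D. Theta D t i (X t i \<omega>, U t i \<omega>) = r i"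
  have "(X, U) \<in> dec_feasible D x0 \<longleftrightarrow> (\<forall>t\<in>{..<Horizon D}. \<exists>r\<in>neg_S D t. ?P t r)"
    using True equivalence by (auto simp: dec_feasible_def)
  also have "\<dots> \<longleftrightarrow> (\<exists>r\<in>neg_S_prod D. \<forall>t\<in>{..<Horizon D}. ?P t (r t))"
  proof
    assume "\<forall>t\<in>{..<Horizon D}. \<exists>r\<in>neg_S D t. ?P t r"
    then obtain r where r: "\<forall>t\<in>{..<Horizon D}. r t \<in> neg_S D t \<and> ?P t (r t)" by metis
    have "restrict r {..<Horizon D} \<in> neg_S_prod D"
      using r by (auto simp: neg_S_prod_def)
    then show "\<exists>r\<in>neg_S_prod D. \<forall>t\<in>{..<Horizon D}. ?P t (r t)"
      by (rule bexI[rotated]) (use r in simp)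
  next
    assume "\<exists>r\<in>neg_S_prod D. \<forall>t\<in>{..<Horizon D}. ?P t (r t)"
    then show "\<forall>t\<in>{..<Horizon D}. \<exists>r\<in>neg_S D t. ?P t r"
      unfolding neg_S_prod_def by (blast dest: PiE_mem)
  qed
  also have "\<dots> \<longleftrightarrow> (\<exists>r\<in>neg_S_prod D. \<forall>i\<in>Units D.
      ((\<lambda>t. X t i), (\<lambda>t. U t i)) \<in> local_feasible D i (\<lambda>t. r t i) (x0 i))"
    using True unfolding admissible_def local_feasible_def
    by (intro bex_cong refl) auto
  finally show ?thesis using True by simp
next
  case False
  then show ?thesis by (simp add: dec_feasible_def)
qed

lemma (in multiunit_problem) expectation_total_cost:
  assumes proc: "\<And>i. i \<in> Units D \<Longrightarrow> local_process D i (\<lambda>t. X t i) (\<lambda>t. U t i)"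
    and exp_defined: "\<And>i. i \<in> Units D \<Longrightarrow>
      expectation_defined (Prob D) (local_cost D i (\<lambda>t. X t i) (\<lambda>t. U t i))"
    and gt: "\<And>i. i \<in> Units D \<Longrightarrow>
      - \<infinity> < ereal_expectation (Prob D) (local_cost D i (\<lambda>t. X t i) (\<lambda>t. U t i))"
  shows "ereal_expectation (Prob D) (total_cost D X U) =
    (\<Sum>i\<in>Units D. ereal_expectation (Prob D) (local_cost D i (\<lambda>t. X t i) (\<lambda>t. U t i)))"
proof -
  have "total_cost D X U = (\<lambda>\<omega>. \<Sum>i\<in>Units D. local_cost D i (\<lambda>t. X t i) (\<lambda>t. U t i) \<omega>)"
    by (rule ext) (rule total_cost_eq_sum_local_cost)
  moreover have "ereal_expectation (Prob D)
      (\<lambda>\<omega>. \<Sum>i\<in>Units D. local_cost D i (\<lambda>t. X t i) (\<lambda>t. U t i) \<omega>) =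
    (\<Sum>i\<in>Units D. ereal_expectation (Prob D) (local_cost D i (\<lambda>t. X t i) (\<lambda>t. U t i)))"
  proof (rule ereal_expectation_sum)
    fix i assume i: "i \<in> Units D"
    show "local_cost D i (\<lambda>t. X t i) (\<lambda>t. U t i) \<in> borel_measurable (Prob D)"
      using exp_defined[OF i] by (simp add: expectation_defined_def)
    show "(\<integral>\<^sup>+ \<omega>. e2ennreal (- local_cost D i (\<lambda>t. X t i) (\<lambda>t. U t i) \<omega>) \<partial>Prob D) < \<infinity>"
      by (rule negative_part_finite[OF exp_defined[OF i] gt[OF i]])
    show "- \<infinity> < local_cost D i (\<lambda>t. X t i) (\<lambda>t. U t i) \<omega>" if "\<omega> \<in> space (Prob D)" for \<omega>
      by (rule local_cost_gt[OF i proc[OF i] that])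
  qed (rule finite_units)
  ultimately show ?thesis by simp
qed

theorem proposition6:
  fixes D :: "('i, 'x, 'u, 'w, 'r::real_vector, 'o) multiunit"
    and x0 :: "'i \<Rightarrow> 'x"
  assumes problem: "multiunit_problem D"
    and x0: "x0 \<in> (\<Pi>\<^sub>E i\<in>Units D. space (X_sp D 0 i))"
    and dec_expectations: "\<And>X U. (X, U) \<in> dec_feasible D x0 \<Longrightarrow>
      expectation_defined (Prob D) (total_cost D X U)"
    and local_expectations: "\<And>r i X U. \<lbrakk>r \<in> neg_S_prod D; i \<in> Units D;
      (X, U) \<in> local_feasible D i (\<lambda>t. r t i) (x0 i)\<rbrakk> \<Longrightarrow>
      expectation_defined (Prob D) (local_cost D i X U)"
    and local_value_gt: "\<And>r i. \<lbrakk>r \<in> neg_S_prod D; i \<in> Units D\<rbrakk> \<Longrightarrow>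
      - \<infinity> < V_local D i (\<lambda>t. r t i) (x0 i)"
    and equivalence: "\<And>t X U. \<lbrakk>t < Horizon D; admissible D x0 X U\<rbrakk> \<Longrightarrow>
      coupling_constraint D t X U \<longleftrightarrow>
      (\<exists>r\<in>neg_S D t. \<forall>i\<in>Units D. AE \<omega> in Prob D. Theta D t i (X t i \<omega>, U t i \<omega>) = r i)"
  shows "V_dec D x0 = (INF r\<in>neg_S_prod D. \<Sum>i\<in>Units D. V_local D i (\<lambda>t. r t i) (x0 i))"
proof -
  interpret multiunit_problem D by (rule problem)
  let ?F = "\<lambda>r i. local_feasible D i (\<lambda>t. r t i) (x0 i)"
  let ?E = "\<lambda>i (X, U). ereal_expectation (Prob D) (local_cost D i X U)"
  let ?at = "\<lambda>X i. \<lambda>t. X t i"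
  have total: "ereal_expectation (Prob D) (total_cost D X U) =
      (\<Sum>i\<in>Units D. ?E i (?at X i, ?at U i))"
    if r: "r \<in> neg_S_prod D" and XU: "\<And>i. i \<in> Units D \<Longrightarrow> (?at X i, ?at U i) \<in> ?F r i" for r X U
  proof -
    have "- \<infinity> < ereal_expectation (Prob D) (local_cost D i (?at X i) (?at U i))"
      if i: "i \<in> Units D" for i
    proof -
      have "V_local D i (\<lambda>t. r t i) (x0 i) \<le> ?E i (?at X i, ?at U i)"
        unfolding V_local_def by (rule INF_lower) (rule XU[OF i])
      then show ?thesis using local_value_gt[OF r i] by auto
    qed
    moreover have "local_process D i (?at X i) (?at U i)" if "i \<in> Units D" for i
      using XU[OF that] by (simp add: local_feasible_def admissible_local_def)
    ultimately show ?thesis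
      unfolding prod.case by (intro expectation_total_cost local_expectations[OF r _ XU])
  qed
  have feasible: "(X, U) \<in> dec_feasible D x0 \<longleftrightarrow> admissible D x0 X U \<and>
      (\<exists>r\<in>neg_S_prod D. \<forall>i\<in>Units D. (?at X i, ?at U i) \<in> ?F r i)" for X U
    using equivalence by (rule dec_feasible_iff_local_feasible)
  have "V_dec D x0 = (INF r\<in>neg_S_prod D. INF z\<in>Pi\<^sub>E (Units D) (?F r). \<Sum>i\<in>Units D. ?E i (z i))"
  proof (rule antisym)
    show "V_dec D x0 \<le> (INF r\<in>neg_S_prod D. INF z\<in>Pi\<^sub>E (Units D) (?F r). \<Sum>i\<in>Units D. ?E i (z i))"
    proof (intro INF_greatest)
      fix r z assume r: "r \<in> neg_S_prod D" and z: "z \<in> Pi\<^sub>E (Units D) (?F r)"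
      \<comment> \<open>A choice of one feasible pair per unit, read as a pair of joint processes.\<close>
      define X where "X = (\<lambda>t i. fst (z i) t)"
      define U where "U = (\<lambda>t i. snd (z i) t)"
      have z_eq: "(?at X i, ?at U i) = z i" for i by (simp add: X_def U_def)
      have XU: "(?at X i, ?at U i) \<in> ?F r i" if "i \<in> Units D" for i
        using PiE_mem[OF z that] by (simp only: z_eq)
      have "admissible D x0 X U"
        using XU by (simp add: admissible_def local_feasible_def)
      then have "(X, U) \<in> dec_feasible D x0"
        unfolding feasible using r XU by (intro conjI bexI[of _ r] ballI)
      then have "V_dec D x0 \<le> ereal_expectation (Prob D) (total_cost D X U)"
        unfolding V_dec_def by (rule INF_lower2) simp
      also have "\<dots> = (\<Sum>i\<in>Units D. ?E i (z i))"
        using total[OF r XU] by (simp only: z_eq)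
      finally show "V_dec D x0 \<le> (\<Sum>i\<in>Units D. ?E i (z i))" .
    qed
  next
    show "(INF r\<in>neg_S_prod D. INF z\<in>Pi\<^sub>E (Units D) (?F r). \<Sum>i\<in>Units D. ?E i (z i)) \<le> V_dec D x0"
      unfolding V_dec_def
    proof (rule INF_greatest, clarify)
      fix X U assume "(X, U) \<in> dec_feasible D x0"
      then obtain r where r: "r \<in> neg_S_prod D"
        and XU: "\<And>i. i \<in> Units D \<Longrightarrow> (?at X i, ?at U i) \<in> ?F r i"
        unfolding feasible by (elim conjE bexE) (rule that, assumption, erule bspec)
      let ?z = "\<lambda>i\<in>Units D. (?at X i, ?at U i)"
      have "(INF r\<in>neg_S_prod D. INF z\<in>Pi\<^sub>E (Units D) (?F r). \<Sum>i\<in>Units D. ?E i (z i))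
          \<le> (INF z\<in>Pi\<^sub>E (Units D) (?F r). \<Sum>i\<in>Units D. ?E i (z i))"
        by (rule INF_lower) (rule r)
      also have "\<dots> \<le> (\<Sum>i\<in>Units D. ?E i (?z i))"
        by (rule INF_lower) (use XU in auto)
      also have "\<dots> = ereal_expectation (Prob D) (total_cost D X U)"
        using total[OF r XU] by simp
      finally show "(INF r\<in>neg_S_prod D. INF z\<in>Pi\<^sub>E (Units D) (?F r). \<Sum>i\<in>Units D. ?E i (z i))
          \<le> ereal_expectation (Prob D) (total_cost D X U)" .
    qed
  qed
  also have "\<dots> = (INF r\<in>neg_S_prod D. \<Sum>i\<in>Units D. V_local D i (\<lambda>t. r t i) (x0 i))"
  proof (rule INF_cong[OF refl])
    fix r assume r: "r \<in> neg_S_prod D"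
    show "(INF z\<in>Pi\<^sub>E (Units D) (?F r). \<Sum>i\<in>Units D. ?E i (z i)) =
        (\<Sum>i\<in>Units D. V_local D i (\<lambda>t. r t i) (x0 i))"
      unfolding V_local_def
      by (rule sum_INF_eq_INF_sum[symmetric, OF finite_units])
        (use local_value_gt[OF r] in \<open>simp add: V_local_def\<close>)
  qed
  finally show ?thesis .
qed

end
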